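(* Let $n\ge2$ be an integer that is not of the form $p^k$ ($p$ prime, $k\ge1$), not of the form $pq$ ($p,q$ distinct primes), and not equal to $12$. Then there exists a realizable flag type $T$ of degree $n$ such that \[P_T\not\subseteq\bigcup_{(p_1,\dots,p_t)}P_{T(p_1,\dots,p_t)},\] where the union is over all tuples $(p_1,\dots,p_t)$ of primes with $p_1\cdots p_t=n$.
   Context: Let $[n]=\{0,\dots,n-1\}$. A flag type of degree $n$ is a function $T:[n]\times[n]\to[n]$ such that $T(i,j)=T(j,i)$, $T(i,0)=i$, and $T(i,j)\le T(i+1,j)$ for $i<n-1$. A flag of a finite abelian group $G$ of order $n$ (written multiplicatively) is a chain of subsets $\{1\}=F_0\subset\cdots\subset F_{n-1}=G$ with $|F_i|=i+1$; a flag of a degree $n$ field extension $L/K$ is a chain of $K$-subspaces $K=F_0\subset\cdots\subset F_{n-1}=L$ with $\dim_KF_i=i+1$. The flag type of a flag is $T_{\mathcal F}(i,j)=\min\{k: F_iF_j\subseteq F_k\}$, where $F_iF_j$ is the set of products (groups) or the $K$-span of products (fields). A flag type is realizable if it equals $T_{\mathcal F}$ for some flag of a finite abelian group or finite field extension. $P_T$ is the set of $\mathbf x\in\mathbb R^{n-1}$ with $0\le x_1\le\cdots\le x_{n-1}$ and $x_{T(i,j)}\le x_i+x_j$ for all $1\le i,j<n$. For a tuple $(p_1,\dots,p_t)$ of integers $>1$ with product $n$, write $m\in[n]$ as $m=m_1+m_2p_1+\cdots+m_tp_1\cdots p_{t-1}$ ($0\le m_s<p_s$), let $H=C_{p_1}\times\cdots\times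 C_{p_t}$, $e_s$ a generator of the $s$-th factor, $v_m=e_1^{m_1}\cdots e_t^{m_t}$, $F_m=\{v_0,\dots,v_m\}$; $T(p_1,\dots,p_t)$ is the flag type of this flag of $H$. *)

theory Defs
  imports
    "HOL-Algebra.Product_Groups"
    "HOL-Algebra.Elementary_Groups"
    "HOL-Algebra.Embedded_Algebras"
    "HOL-Computational_Algebra.Primes"
    Complex_Main
begin

text \<open>Flag types of degree \<open>n\<close>. Only the values of \<open>T\<close> on \<open>[n] \<times> [n]\<close> are meaningful; values of
  the HOL function outside this square are never inspected.\<close>

definition flag_type :: "nat \<Rightarrow> (nat \<Rightarrow> nat \<Rightarrow> nat) \<Rightarrow> bool" where
  "flag_type n T \<longleftrightarrow>
     (\<forall>i<n. \<forall>j<n. T i j < n) \<and>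
     (\<forall>i<n. \<forall>j<n. T i j = T j i) \<and>
     (\<forall>i<n. T i 0 = i) \<and>
     (\<forall>i j. i < n - 1 \<and> j < n \<longrightarrow> T i j \<le> T (i + 1) j)"

definition group_flag :: "('a, 'b) monoid_scheme \<Rightarrow> nat \<Rightarrow> (nat \<Rightarrow> 'a set) \<Rightarrow> bool" where
  "group_flag G n F \<longleftrightarrow>
     F 0 = {\<one>\<^bsub>G\<^esub>} \<and> F (n - 1) = carrier G \<and>
     (\<forall>i. i < n - 1 \<longrightarrow> F i \<subset> F (i + 1)) \<and>
     (\<forall>i<n. card (F i) = i + 1)"

definition group_flag_type ::
    "('a, 'b) monoid_scheme \<Rightarrow> nat \<Rightarrow> (nat \<Rightarrow> 'a set) \<Rightarrow> nat \<Rightarrow> nat \<Rightarrow> nat" where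
  "group_flag_type G n F i j = (LEAST k. k < n \<and> F i <#>\<^bsub>G\<^esub> F j \<subseteq> F k)"

definition field_extension :: "('a, 'b) ring_scheme \<Rightarrow> 'a set \<Rightarrow> nat \<Rightarrow> bool" where
  "field_extension L K n \<longleftrightarrow> field L \<and> subfield K L \<and> ring.dimension L n K (carrier L)"

text \<open>The library predicate \<open>ring.dimension L m K E\<close> includes that \<open>E\<close> is a \<open>K\<close>-subspace of \<open>L\<close>.\<close>

definition field_flag :: "('a, 'b) ring_scheme \<Rightarrow> 'a set \<Rightarrow> nat \<Rightarrow> (nat \<Rightarrow> 'a set) \<Rightarrow> bool" where
  "field_flag L K n F \<longleftrightarrow>
     F 0 = K \<and> F (n - 1) = carrier L \<and>
     (\<forall>i. i < n - 1 \<longrightarrow> F i \<subset> F (i + 1)) \<and>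
     (\<forall>i<n. ring.dimension L (i + 1) K (F i))"

text \<open>The \<open>K\<close>-span of a possibly infinite set \<open>S\<close>: the additive subgroup generated by all products
  of an element of \<open>K\<close> with an element of \<open>S\<close>. For \<open>S = set Us\<close> this is the library's
  \<open>ring.Span L K Us\<close>, by \<open>Span_eq_generate\<close>.\<close>

definition span_over :: "('a, 'b) ring_scheme \<Rightarrow> 'a set \<Rightarrow> 'a set \<Rightarrow> 'a set" where
  "span_over L K S = generate (add_monoid L) (K <#>\<^bsub>L\<^esub> S)"

definition field_flag_type ::
    "('a, 'b) ring_scheme \<Rightarrow> 'a set \<Rightarrow> nat \<Rightarrow> (nat \<Rightarrow> 'a set) \<Rightarrow> nat \<Rightarrow> nat \<Rightarrow> nat" where
  "field_flag_type L K n F i j =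
     (LEAST k. k < n \<and> span_over L K (F i <#>\<^bsub>L\<^esub> F j) \<subseteq> F k)"

definition realized_by_group :: "('a, 'b) monoid_scheme \<Rightarrow> nat \<Rightarrow> (nat \<Rightarrow> nat \<Rightarrow> nat) \<Rightarrow> bool" where
  "realized_by_group G n T \<longleftrightarrow>
     comm_group G \<and> finite (carrier G) \<and> order G = n \<and>
     (\<exists>F. group_flag G n F \<and> (\<forall>i<n. \<forall>j<n. T i j = group_flag_type G n F i j))"

definition realized_by_field ::
    "('a, 'b) ring_scheme \<Rightarrow> 'a set \<Rightarrow> nat \<Rightarrow> (nat \<Rightarrow> nat \<Rightarrow> nat) \<Rightarrow> bool" where
  "realized_by_field L K n T \<longleftrightarrow>
     field_extension L K n \<and>
     (\<exists>F. field_flag L K n F \<and> (\<forall>i<n. \<forall>j<n. T i j = field_flag_type L K n F i j))"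

text \<open>HOL cannot quantify existentially over types, so the witnesses are taken with carriers in
  \<open>nat\<close>. This loses no flag types. Every finite group is isomorphic to one with carrier in \<open>nat\<close>.
  For a flag \<open>F\<close> of a degree \<open>n\<close> extension \<open>L/K\<close>, choose a basis \<open>b\<^sub>0 = 1, b\<^sub>1, \<dots>\<close> of \<open>L\<close> adapted
  to \<open>F\<close> and let \<open>K'\<close> be the subfield of \<open>K\<close> generated by the finitely many structure constants of
  the multiplication. The \<open>K'\<close>-span \<open>L'\<close> of the basis is a domain of finite dimension over \<open>K'\<close>,
  hence a field, it is countable, and the \<open>K'\<close>-spans of \<open>b\<^sub>0, \<dots>, b\<^sub>i\<close> form a flag of \<open>L'/K'\<close> with
  the same flag type as \<open>F\<close>.\<close>

definition realizable :: "nat \<Rightarrow> (nat \<Rightarrow> nat \<Rightarrow> nat) \<Rightarrow> bool" where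
  "realizable n T \<longleftrightarrow>
     (\<exists>G :: nat monoid. realized_by_group G n T) \<or>
     (\<exists>(L :: nat ring) K. realized_by_field L K n T)"

text \<open>\<open>\<real>\<^bsup>n-1\<^esup>\<close> is the set of extensional functions on the index set \<open>{1..<n}\<close>. For a flag type \<open>T\<close>
  and \<open>1 \<le> i, j < n\<close> one has \<open>1 \<le> j \<le> T i j < n\<close>, so \<open>x (T i j)\<close> is always a genuine coordinate.\<close>

definition flag_polytope :: "nat \<Rightarrow> (nat \<Rightarrow> nat \<Rightarrow> nat) \<Rightarrow> (nat \<Rightarrow> real) set" where
  "flag_polytope n T =
     {x \<in> {1..<n} \<rightarrow>\<^sub>E UNIV.
        (\<forall>i\<in>{1..<n}. 0 \<le> x i) \<and>
        (\<forall>i\<in>{1..<n}. \<forall>j\<in>{1..<n}. i \<le> j \<longrightarrow> x i \<le> x j) \<and>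
        (\<forall>i\<in>{1..<n}. \<forall>j\<in>{1..<n}. x (T i j) \<le> x i + x j)}"

text \<open>Tuples \<open>(p\<^sub>1, \<dots>, p\<^sub>t)\<close> are lists, with factors and digits indexed from \<open>0\<close>. The \<open>s\<close>-th digit
  of \<open>m\<close> has place value the product of the first \<open>s\<close> entries.\<close>

definition digit :: "nat list \<Rightarrow> nat \<Rightarrow> nat \<Rightarrow> nat" where
  "digit ps m s = (m div prod_list (take s ps)) mod (ps ! s)"

definition tuple_group :: "nat list \<Rightarrow> (nat \<Rightarrow> int) monoid" where
  "tuple_group ps = product_group {..<length ps} (\<lambda>s. integer_mod_group (ps ! s))"

text \<open>The residue class of \<open>1\<close> serves as the generator of each cyclic factor; another choice changes
  the flag by an automorphism of the group and so does not affect its flag type.\<close>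

definition tuple_generator :: "nat list \<Rightarrow> nat \<Rightarrow> (nat \<Rightarrow> int)" where
  "tuple_generator ps s =
     (\<lambda>r\<in>{..<length ps}. if r = s then 1 else \<one>\<^bsub>integer_mod_group (ps ! r)\<^esub>)"

definition tuple_element :: "nat list \<Rightarrow> nat \<Rightarrow> (nat \<Rightarrow> int)" where
  "tuple_element ps m =
     (\<Otimes>\<^bsub>tuple_group ps\<^esub> s\<in>{..<length ps}.
        tuple_generator ps s [^]\<^bsub>tuple_group ps\<^esub> digit ps m s)"

definition tuple_flag :: "nat list \<Rightarrow> nat \<Rightarrow> (nat \<Rightarrow> int) set" where
  "tuple_flag ps m = tuple_element ps ` {..m}"

definition tuple_flag_type :: "nat list \<Rightarrow> nat \<Rightarrow> nat \<Rightarrow> nat" where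
  "tuple_flag_type ps = group_flag_type (tuple_group ps) (prod_list ps) (tuple_flag ps)"

end

theory Submission
  imports Defs
begin

text \<open>
  Order a finite abelian group \<open>G\<close> by a subadditive function \<open>w\<close> vanishing only at \<open>1\<close>. The sorted
  values of \<open>w\<close> form a point \<open>x\<close> of \<open>P\<^sub>T\<close>, where \<open>T\<close> is the type of the resulting flag. If \<open>i + j\<close>
  is computed without carries in the mixed radix \<open>(p\<^sub>1, \<dots>, p\<^sub>t)\<close>, then every point of
  \<open>P\<^bsub>T(p\<^sub>1, \<dots>, p\<^sub>t)\<^esub>\<close> satisfies \<open>x\<^bsub>i+j\<^esub> \<le> x\<^sub>i + x\<^sub>j\<close>. So it suffices to find \<open>w\<close> such that every tuple
  admits a carry-free pair \<open>i, j\<close> violating this inequality.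

  If \<open>n = pqm\<close> with primes \<open>p \<noteq> q\<close> and \<open>m > 2\<close>, take \<open>G = C\<^sub>p \<times> C\<^sub>q \<times> C\<^sub>m\<close>. Let \<open>w\<close> make \<open>C\<^sub>p\<close> much smaller
  than the rest of \<open>C\<^sub>p \<times> C\<^sub>q\<close>, and the latter much smaller than the rest of \<open>G\<close>; this excludes all
  tuples except those starting with \<open>(p, q)\<close>. In the nontrivial cosets of \<open>C\<^sub>p \<times> C\<^sub>q\<close> let instead
  the elements of \<open>C\<^sub>q\<close> come first. The set \<open>F\<close> of the first \<open>pq + q\<close> elements then satisfies
  \<open>|F \<cdot> F| = 2pq + q\<close>, which excludes \<open>(p, q, r, \<dots>)\<close> for \<open>r > 2\<close>. For \<open>r = 2\<close>, multiply \<open>F\<close> instead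
  by the set of the first \<open>2pq + q\<close> elements.

  The only other values of \<open>n\<close> are \<open>4q\<close> with a prime \<open>q \<ge> 5\<close>. Here \<open>G = C\<^sub>2 \<times> C\<^sub>q \<times> C\<^sub>2\<close>. The first
  nontrivial element lies in \<open>C\<^sub>q\<close> and stabilizes the set of the first \<open>3q\<close> elements, which excludes
  the tuples starting with \<open>2\<close>. From the fourth element on, \<open>C\<^sub>2 \<times> C\<^sub>q\<close> is filled by successive cosets
  of the first factor \<open>C\<^sub>2\<close>, which excludes \<open>(q, 2, 2)\<close>.
\<close>

subsection \<open>Carry-free addition and the flags of tuples\<close>

text \<open>What remains of \<open>i\<close> and \<open>j\<close> above the last digit is ignored;
  where it matters, \<open>i + j < prod_list ps\<close> is assumed separately.\<close>

fun no_carry :: "nat list \<Rightarrow> nat \<Rightarrow> nat \<Rightarrow> bool" where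
  "no_carry [] i j \<longleftrightarrow> True"
| "no_carry (p # ps) i j \<longleftrightarrow> i mod p + j mod p < p \<and> no_carry ps (i div p) (j div p)"

lemma no_carry_0:
  assumes "\<forall>p\<in>set ps. p > 0"
  shows "no_carry ps 0 j" "no_carry ps j 0"
  using assms by (induction ps arbitrary: j) auto

lemma digit_Cons_0: "digit (p # ps) m 0 = m mod p"
  by (simp add: digit_def)

lemma digit_Cons_Suc: "digit (p # ps) m (Suc s) = digit ps (m div p) s"
  by (simp add: digit_def div_mult2_eq)

lemma digit_add:
  assumes "no_carry ps i j" "s < length ps"
  shows "digit ps (i + j) s = digit ps i s + digit ps j s"
  using assms
proof (induction ps arbitrary: i j s)
  case (Cons p ps)
  have "(i + j) mod p = i mod p + j mod p" "(i + j) div p = i div p + j div p"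
    using Cons.prems(1) mod_add_eq[of i p j] by (simp_all add: div_add1_eq)
  with Cons show ?case
    by (cases s) (simp_all add: digit_Cons_0 digit_Cons_Suc)
qed simp

lemma digit_inject:
  assumes "\<And>s. s < length ps \<Longrightarrow> digit ps i s = digit ps j s"
    and "i < prod_list ps" "j < prod_list ps"
  shows "i = j"
  using assms
proof (induction ps arbitrary: i j)
  case (Cons p ps)
  have "i mod p = j mod p"
    using Cons.prems(1)[of 0] by (simp add: digit_Cons_0)
  moreover have "i div p = j div p"
  proof (rule Cons.IH)
    show "digit ps (i div p) s = digit ps (j div p) s" if "s < length ps" for s
      using Cons.prems(1)[of "Suc s"] that by (simp add: digit_Cons_Suc)
    show "i div p < prod_list ps" "j div p < prod_list ps"
      using Cons.prems(2,3) by (simp_all add: less_mult_imp_div_less mult.commute)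
  qed
  ultimately show ?case
    by (metis div_mult_mod_eq)
qed simp

lemma digit_less:
  assumes "\<forall>p\<in>set ps. p > 1" "s < length ps"
  shows "digit ps m s < ps ! s"
proof -
  have "ps ! s > 1"
    using assms by simp
  then show ?thesis
    by (simp add: digit_def)
qed

lemma comm_group_tuple_group: "comm_group (tuple_group ps)"
proof (rule group.group_comm_groupI)
  show "group (tuple_group ps)"
    by (simp add: tuple_group_def)
qed (auto simp: tuple_group_def add.commute)

lemma tuple_generator_carrier:
  assumes "\<forall>p\<in>set ps. p > 1"
  shows "tuple_generator ps s \<in> carrier (tuple_group ps)"
proof -
  have "ps ! r > 1" if "r < length ps" for r
    using assms that by simp
  then show ?thesis
    by (auto simp: tuple_generator_def tuple_group_def carrier_integer_mod_group)
qed

lemma tuple_generator_pow: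
  assumes "\<forall>p\<in>set ps. p > 1" "s < length ps" "k < ps ! s"
  shows "tuple_generator ps s [^]\<^bsub>tuple_group ps\<^esub> k =
    (\<lambda>r\<in>{..<length ps}. if r = s then int k else 0)"
  using assms(3)
proof (induction k)
  case 0
  then show ?case
    by (auto simp: tuple_group_def)
next
  case (Suc k)
  then show ?case
    using assms
    by (auto simp: tuple_group_def tuple_generator_def fun_eq_iff)
qed

text \<open>Induction over the set of factors already multiplied: the generators occupy distinct
  coordinates, and each digit is below its radix, so no coordinate wraps around.\<close>

lemma tuple_element_eq:
  assumes ps: "\<forall>p\<in>set ps. p > 1"
  shows "tuple_element ps m = (\<lambda>r\<in>{..<length ps}. int (digit ps m r))"
proof -
  interpret comm_group "tuple_group ps"
    by (rule comm_group_tuple_group)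
  have d: "digit ps m s < ps ! s" if "s < length ps" for s
    using digit_less[OF ps that] .
  have "(\<Otimes>\<^bsub>tuple_group ps\<^esub> s\<in>A. tuple_generator ps s [^]\<^bsub>tuple_group ps\<^esub> digit ps m s) =
      (\<lambda>r\<in>{..<length ps}. if r \<in> A then int (digit ps m r) else 0)"
    if "finite A" "A \<subseteq> {..<length ps}" for A
    using that
  proof (induction A)
    case empty
    show ?case
      by (simp only: finprod_empty) (simp add: tuple_group_def)
  next
    case (insert s A)
    have "(\<Otimes>\<^bsub>tuple_group ps\<^esub> s\<in>insert s A. tuple_generator ps s [^]\<^bsub>tuple_group ps\<^esub> digit ps m s) =
      (\<lambda>r\<in>{..<length ps}. if r = s then int (digit ps m r) else 0) \<otimes>\<^bsub>tuple_group ps\<^esub>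
      (\<lambda>r\<in>{..<length ps}. if r \<in> A then int (digit ps m r) else 0)"
    proof -
      have IH: "(\<Otimes>\<^bsub>tuple_group ps\<^esub> s\<in>A. tuple_generator ps s [^]\<^bsub>tuple_group ps\<^esub> digit ps m s) =
          (\<lambda>r\<in>{..<length ps}. if r \<in> A then int (digit ps m r) else 0)"
        by (rule insert(3)) (use insert(4) in auto)
      have pow: "tuple_generator ps s [^]\<^bsub>tuple_group ps\<^esub> digit ps m s =
          (\<lambda>r\<in>{..<length ps}. if r = s then int (digit ps m r) else 0)"
        using insert(4) by (subst tuple_generator_pow[OF ps _ d]) auto
      show ?thesis
        unfolding pow[symmetric] IH[symmetric] using tuple_generator_carrier[OF ps]
        by (intro finprod_insert insert(1,2)) auto
    qed
    also have "\<dots> = (\<lambda>r\<in>{..<length ps}. if r \<in> insert s A then int (digit ps m r) else 0)"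
      using insert(2) d by (auto simp: tuple_group_def fun_eq_iff)
    finally show ?case .
  qed
  from this[of "{..<length ps}"] show ?thesis
    by (auto simp: tuple_element_def fun_eq_iff)
qed

lemma tuple_element_mult:
  assumes "\<forall>p\<in>set ps. p > 1" "no_carry ps i j"
  shows "tuple_element ps i \<otimes>\<^bsub>tuple_group ps\<^esub> tuple_element ps j = tuple_element ps (i + j)"
proof -
  have "(int (digit ps i s) + int (digit ps j s)) mod int (ps ! s) = int (digit ps (i + j) s)"
    if "s < length ps" for s
    using digit_less[OF assms(1) that, of "i + j"] digit_add[OF assms(2) that]
    by (metis mod_less of_nat_add of_nat_mod)
  then show ?thesis
    unfolding tuple_element_eq[OF assms(1)]
    by (auto simp: tuple_group_def fun_eq_iff)
qed

lemma bij_betw_tuple_element: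
  assumes ps: "\<forall>p\<in>set ps. p > 1"
  shows "bij_betw (tuple_element ps) {..<prod_list ps} (carrier (tuple_group ps))"
proof -
  have inj: "inj_on (tuple_element ps) {..<prod_list ps}"
  proof (rule inj_onI)
    fix i j
    assume "i \<in> {..<prod_list ps}" "j \<in> {..<prod_list ps}" "tuple_element ps i = tuple_element ps j"
    then show "i = j"
      using digit_inject[of ps i j] fun_cong[of "tuple_element ps i" "tuple_element ps j"]
      unfolding tuple_element_eq[OF ps] by (metis lessThan_iff of_nat_eq_iff restrict_apply')
  qed
  have nz: "ps ! s \<noteq> 0" if "s < length ps" for s
    using digit_less[OF ps that] by (metis not_less0)
  have car: "carrier (tuple_group ps) = (\<Pi>\<^sub>E s\<in>{..<length ps}. {0..<int (ps ! s)})"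
    unfolding tuple_group_def carrier_product_group carrier_integer_mod_group
    by (rule PiE_cong) (use nz in auto)
  have "tuple_element ps ` {..<prod_list ps} \<subseteq> carrier (tuple_group ps)"
    unfolding car tuple_element_eq[OF ps] by (auto intro: digit_less[OF ps] split: if_splits)
  moreover have "card (carrier (tuple_group ps)) = prod_list ps"
    unfolding car prod.list_conv_set_nth lessThan_atLeast0 by (simp add: card_PiE)
  moreover have "finite (carrier (tuple_group ps))"
    unfolding car by (intro finite_PiE) auto
  ultimately have "tuple_element ps ` {..<prod_list ps} = carrier (tuple_group ps)"
    by (intro card_subset_eq) (auto simp: card_image[OF inj])
  with inj show ?thesis
    by (simp add: bij_betw_def)
qed

text \<open>Without carries the elements numbered \<open>i\<close> and \<open>j\<close> multiply to
  the one numbered \<open>i + j\<close>; the numbering being injective, only flag members from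
  \<open>i + j\<close> on contain it. The upper bound keeps the value among the coordinates on which
  points of the polytope are monotone.\<close>

lemma tuple_flag_type_ge:
  assumes ps: "\<forall>p\<in>set ps. p > 1" and nc: "no_carry ps i j" and ij: "i + j < prod_list ps"
  shows "i + j \<le> tuple_flag_type ps i j" "tuple_flag_type ps i j < prod_list ps"
proof -
  interpret comm_group "tuple_group ps"
    by (rule comm_group_tuple_group)
  let ?n = "prod_list ps" and ?e = "tuple_element ps" and ?G = "tuple_group ps"
  let ?P = "\<lambda>k. k < ?n \<and> tuple_flag ps i <#>\<^bsub>?G\<^esub> tuple_flag ps j \<subseteq> tuple_flag ps k"
  note bij = bij_betw_tuple_element[OF ps]
  have "{..?n - 1} = {..<?n}"
    using ij by auto
  then have "tuple_flag ps (?n - 1) = carrier ?G"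
    using bij by (simp add: tuple_flag_def bij_betw_def)
  moreover have "tuple_flag ps k \<subseteq> carrier ?G" if "k < ?n" for k
    using bij that by (force simp: tuple_flag_def bij_betw_def)
  ultimately have "?P (?n - 1)"
    using ij by (simp add: set_mult_closed)
  then have *: "?P (tuple_flag_type ps i j)"
    unfolding tuple_flag_type_def group_flag_type_def by (rule LeastI)
  then show "tuple_flag_type ps i j < ?n"
    by simp
  have "?e (i + j) \<in> tuple_flag ps i <#>\<^bsub>?G\<^esub> tuple_flag ps j"
    unfolding tuple_element_mult[OF ps nc, symmetric] set_mult_def tuple_flag_def by blast
  with * obtain k where "k \<le> tuple_flag_type ps i j" "?e (i + j) = ?e k"
    by (auto simp: tuple_flag_def)
  moreover from this have "i + j = k"
    using * ij bij inj_onD[of ?e "{..<?n}" "i + j" k] by (simp add: bij_betw_def)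
  ultimately show "i + j \<le> tuple_flag_type ps i j"
    by simp
qed

lemma flag_polytope_tuple_le:
  assumes x: "x \<in> flag_polytope (prod_list ps) (tuple_flag_type ps)"
    and ps: "\<forall>p\<in>set ps. p > 1" and nc: "no_carry ps i j"
    and ij: "i > 0" "j > 0" "i + j < prod_list ps"
  shows "x (i + j) \<le> x i + x j"
proof -
  have "x (i + j) \<le> x (tuple_flag_type ps i j)"
    using x ij tuple_flag_type_ge[OF ps nc ij(3)] by (auto simp: flag_polytope_def)
  also have "\<dots> \<le> x i + x j"
    using x ij by (auto simp: flag_polytope_def)
  finally show ?thesis .
qed

text \<open>Only place values have digit sum 1; any larger digit sum can be divided digitwise. The
  lowest digit is split if \<open>N < p\<close>, separated from the rest if it is nonzero, and
  dropped by dividing by \<open>p\<close> otherwise.\<close>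

lemma ex_no_carry_decomp:
  assumes "\<forall>p\<in>set ps. p > 1" "N > 0" "N < prod_list ps"
    and "\<And>k. N \<noteq> prod_list (take k ps)"
  shows "\<exists>i j. i > 0 \<and> j > 0 \<and> i + j = N \<and> no_carry ps i j"
  using assms
proof (induction ps arbitrary: N)
  case (Cons p ps)
  have p: "p > 1" and ps: "\<forall>p\<in>set ps. p > 0"
    using Cons.prems(1) by auto
  have N1: "N \<noteq> 1"
    using Cons.prems(4)[of 0] by simp
  consider "N < p" | "N \<ge> p" "N mod p \<noteq> 0" | "N \<ge> p" "N mod p = 0"
    by linarith
  then show ?case
  proof cases
    case 1
    have "no_carry (p # ps) 1 (N - 1)"
      using 1 p ps Cons.prems(2) by (auto simp: no_carry_0)
    then show ?thesis
      using N1 Cons.prems(2) by (intro exI[of _ 1] exI[of _ "N - 1"]) auto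
  next
    case 2
    have "no_carry (p # ps) (N mod p) (N div p * p)"
      using 2 p ps by (auto simp: no_carry_0)
    then show ?thesis
      using 2 p by (intro exI[of _ "N mod p"] exI[of _ "N div p * p"]) (auto simp: div_greater_zero_iff)
  next
    case 3
    then obtain M where N: "N = p * M"
      by auto
    have "\<exists>i j. i > 0 \<and> j > 0 \<and> i + j = M \<and> no_carry ps i j"
    proof (rule Cons.IH)
      show "M \<noteq> prod_list (take k ps)" for k
        using Cons.prems(4)[of "Suc k"] N by auto
    qed (use Cons.prems N in auto)
    then obtain i j where "i > 0" "j > 0" "i + j = M" "no_carry ps i j"
      by blast
    then show ?thesis
      using p N by (intro exI[of _ "p * i"] exI[of _ "p * j"]) (auto simp: algebra_simps)
  qed
qed simp

text \<open>A product of primes that is itself prime has a single factor. This reads off the leading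
  entries of a tuple.\<close>

lemma prime_eq_prod_list_take:
  assumes "\<forall>p\<in>set ps. prime p" "prime (q :: nat)" "q = prod_list (take k ps)"
  shows "\<exists>qs. ps = q # qs"
proof (cases "take k ps")
  case Nil
  then show ?thesis
    using assms(2) unfolding assms(3) by (simp only: prod_list.Nil not_prime_1)
next
  case (Cons r rs)
  then obtain qs where qs: "ps = r # qs"
    by (metis append_Cons append_take_drop_id)
  have "set rs \<subseteq> set ps"
    using Cons by (metis set_subset_Cons set_take_subset subset_trans)
  moreover have "prod_list rs = 1"
    using assms Cons qs by (metis prime_product list.set_intros(1) not_prime_1 prod_list.Cons mult.right_neutral)
  ultimately have "r = q"
    using assms Cons by simp
  with qs show ?thesis
    by blast
qed

subsection \<open>Flags from length functions\<close>

text \<open>By minimality of \<open>T i j\<close>, the element at that position is itself a product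
  of elements at positions at most \<open>i\<close> and \<open>j\<close>; subadditivity and
  monotonicity of \<open>w\<close> then give the polytope inequality.\<close>

lemma realizable_of_enumeration:
  fixes G :: "('a, 'b) monoid_scheme" and w :: "'a \<Rightarrow> real"
  assumes G: "comm_group G" and n: "n > 0"
    and bij: "bij_betw e {..<n} (carrier G)" and e0: "e 0 = \<one>\<^bsub>G\<^esub>"
    and w1: "w \<one>\<^bsub>G\<^esub> = 0"
    and sub: "\<And>g h. g \<in> carrier G \<Longrightarrow> h \<in> carrier G \<Longrightarrow> w (g \<otimes>\<^bsub>G\<^esub> h) \<le> w g + w h"
    and mono: "\<And>i j. i \<le> j \<Longrightarrow> j < n \<Longrightarrow> w (e i) \<le> w (e j)"
  shows "\<exists>T. flag_type n T \<and> realizable n T \<and> (\<lambda>i\<in>{1..<n}. w (e i)) \<in> flag_polytope n T"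
proof -
  interpret G: comm_group G by (rule G)
  define idx where "idx = inv_into {..<n} e"
  have e_idx: "e (idx g) = g" "idx g < n" if "g \<in> carrier G" for g
    using bij that inv_into_into[of g e "{..<n}"]
    by (auto simp: idx_def bij_betw_def f_inv_into_f)
  have idx_e: "idx (e i) = i" and e_car: "e i \<in> carrier G" if "i < n" for i
    using bij that by (auto simp: idx_def bij_betw_def inv_into_f_f)
  \<comment> \<open>Elements are replaced by their positions: the flag becomes
    \<open>atMost\<close>, and the carrier lies in \<open>nat\<close>, as \<open>realizable\<close>
    requires.\<close>
  define N :: "nat monoid" where
    "N = \<lparr>carrier = {..<n}, monoid.mult = (\<lambda>i j. idx (e i \<otimes>\<^bsub>G\<^esub> e j)), one = 0\<rparr>"
  have N_simps: "carrier N = {..<n}" "i \<otimes>\<^bsub>N\<^esub> j = idx (e i \<otimes>\<^bsub>G\<^esub> e j)" "\<one>\<^bsub>N\<^esub> = 0" for i j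
    by (simp_all add: N_def)
  have comm_N: "comm_group N"
  proof (rule comm_groupI)
    show "\<exists>y\<in>carrier N. y \<otimes>\<^bsub>N\<^esub> x = \<one>\<^bsub>N\<^esub>" if "x \<in> carrier N" for x
    proof (rule bexI[of _ "idx (inv\<^bsub>G\<^esub> e x)"])
      show "idx (inv\<^bsub>G\<^esub> e x) \<otimes>\<^bsub>N\<^esub> x = \<one>\<^bsub>N\<^esub>"
        using that idx_e[OF n] by (simp add: N_simps e_idx e_car e0)
    qed (use that in \<open>simp add: N_simps e_idx e_car\<close>)
  qed (use n e0 in \<open>simp_all add: N_simps e_idx e_car idx_e G.m_ac\<close>)
  interpret N: comm_group N by (rule comm_N)
  define T where "T = group_flag_type N n atMost"
  have T_least: "T i j < n" "{..i} <#>\<^bsub>N\<^esub> {..j} \<subseteq> {..T i j}"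
    "\<And>k. k < n \<Longrightarrow> {..i} <#>\<^bsub>N\<^esub> {..j} \<subseteq> {..k} \<Longrightarrow> T i j \<le> k" if "i < n" "j < n" for i j
  proof -
    let ?P = "\<lambda>k. k < n \<and> {..i} <#>\<^bsub>N\<^esub> {..j} \<subseteq> {..k}"
    have "{..i} <#>\<^bsub>N\<^esub> {..j} \<subseteq> carrier N"
      using that by (intro N.set_mult_closed) (auto simp: N_simps)
    then have "?P (n - 1)"
      using n by (force simp: N_simps)
    then have "?P (T i j)"
      unfolding T_def group_flag_type_def by (rule LeastI)
    then show "T i j < n" "{..i} <#>\<^bsub>N\<^esub> {..j} \<subseteq> {..T i j}"
      by auto
    show "T i j \<le> k" if "k < n" "{..i} <#>\<^bsub>N\<^esub> {..j} \<subseteq> {..k}" for k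
      unfolding T_def group_flag_type_def using that by (intro Least_le) auto
  qed
  have mult_0: "{..i} <#>\<^bsub>N\<^esub> {0} = {..i}" if "i < n" for i
    using that N.r_one by (force simp: set_mult_def N_simps)
  have T_0: "T i 0 = i" if "i < n" for i
    using T_least[OF that n] that by (intro order_antisym) (auto simp: mult_0)
  have mult_comm: "A <#>\<^bsub>N\<^esub> B \<subseteq> B <#>\<^bsub>N\<^esub> A" if "A \<subseteq> carrier N" "B \<subseteq> carrier N" for A B
    using that unfolding set_mult_def by (fastforce intro: N.m_comm)
  have T_sym: "T i j = T j i" if "i < n" "j < n" for i j
  proof -
    have "{..i} <#>\<^bsub>N\<^esub> {..j} = {..j} <#>\<^bsub>N\<^esub> {..i}"
      using that by (intro equalityI mult_comm) (auto simp: N_simps)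
    then show ?thesis
      by (simp add: T_def group_flag_type_def)
  qed
  have T_mono: "T i j \<le> T i' j'" if "i \<le> i'" "j \<le> j'" "i' < n" "j' < n" for i i' j j'
  proof -
    have "{..i} <#>\<^bsub>N\<^esub> {..j} \<subseteq> {..i'} <#>\<^bsub>N\<^esub> {..j'}"
      using that by (intro mono_set_mult) auto
    then show ?thesis
      using that T_least(1,2)[of i' j'] by (intro T_least(3)) auto
  qed
  have "flag_type n T"
    unfolding flag_type_def using T_least(1) T_0 by (auto intro: T_sym T_mono)
  moreover have "realizable n T"
  proof -
    have "group_flag N n atMost"
      using n by (auto simp: group_flag_def N_simps)
    then have "realized_by_group N n T"
      using comm_N by (auto simp: realized_by_group_def order_def N_simps T_def)
    then show ?thesis
      by (auto simp: realizable_def)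
  qed
  moreover have "(\<lambda>i\<in>{1..<n}. w (e i)) \<in> flag_polytope n T"
  proof -
    have T_ge: "i \<le> T i j" if "i < n" "j < n" for i j
      using T_mono[of i i 0 j] that by (simp add: T_0)
    have w_T: "w (e (T i j)) \<le> w (e i) + w (e j)" if ij: "i < n" "j < n" "i > 0" for i j
    proof -
      have "T i j > 0"
        using T_ge ij by (metis less_le_trans)
      then have "\<not> {..i} <#>\<^bsub>N\<^esub> {..j} \<subseteq> {..T i j - 1}"
        using T_least(1)[OF ij(1,2)] T_least(3)[OF ij(1,2), of "T i j - 1"] by linarith
      then obtain k where k: "k \<in> {..i} <#>\<^bsub>N\<^esub> {..j}" "\<not> k \<le> T i j - 1"
        by blast
      then have "k \<le> T i j"
        using T_least(2)[OF ij(1,2)] by auto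
      with k have "T i j \<in> {..i} <#>\<^bsub>N\<^esub> {..j}"
        by (metis Suc_pred' \<open>T i j > 0\<close> le_SucE)
      then obtain a b where ab: "a \<le> i" "b \<le> j" "T i j = idx (e a \<otimes>\<^bsub>G\<^esub> e b)"
        by (auto simp: set_mult_def N_simps)
      then have "w (e (T i j)) \<le> w (e a) + w (e b)"
        using ij by (simp add: e_idx e_car sub)
      also have "\<dots> \<le> w (e i) + w (e j)"
        using ab ij by (intro add_mono mono)
      finally show ?thesis .
    qed
    have "0 \<le> w (e i)" if "i < n" for i
      using mono[of 0 i] that by (simp add: e0 w1)
    moreover have "T i j \<in> {1..<n}" if "i \<in> {1..<n}" "j \<in> {1..<n}" for i j
      using T_ge[of i j] T_least(1)[of i j] that by simp
    ultimately show ?thesis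
      unfolding flag_polytope_def using w_T mono by simp
  qed
  ultimately show ?thesis
    by blast
qed

text \<open>Sort by \<open>w\<close>, with indices from 0. An index below the size of the sublevel
  set of \<open>u\<close> has weight at most \<open>u\<close>, and an index not below the size of
  that of \<open>u + v\<close> has weight above \<open>u + v\<close>. Hence \<open>sep\<close> needs
  only cardinalities, and ties may be broken arbitrarily.\<close>

lemma flag_type_of_length_function:
  fixes G :: "('a, 'b) monoid_scheme" and w :: "'a \<Rightarrow> int"
  assumes G: "comm_group G" "finite (carrier G)" "order G = n"
    and pos: "\<And>g. g \<in> carrier G \<Longrightarrow> w g \<ge> 0"
      "\<And>g. g \<in> carrier G \<Longrightarrow> w g = 0 \<longleftrightarrow> g = \<one>\<^bsub>G\<^esub>"
    and sub: "\<And>g h. g \<in> carrier G \<Longrightarrow> h \<in> carrier G \<Longrightarrow> w (g \<otimes>\<^bsub>G\<^esub> h) \<le> w g + w h"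
    and sep: "\<And>ps. \<forall>p\<in>set ps. prime p \<Longrightarrow> prod_list ps = n \<Longrightarrow>
      \<exists>i j u v. no_carry ps i j \<and> 0 < i \<and> 0 < j \<and> i + j < n \<and>
        i < card {g \<in> carrier G. w g \<le> u} \<and> j < card {g \<in> carrier G. w g \<le> v} \<and>
        card {g \<in> carrier G. w g \<le> u + v} \<le> i + j"
  shows "\<exists>T. flag_type n T \<and> realizable n T \<and>
           \<not> flag_polytope n T \<subseteq>
             (\<Union>ps \<in> {ps. (\<forall>p\<in>set ps. prime p) \<and> prod_list ps = n}.
                flag_polytope n (tuple_flag_type ps))"
proof -
  interpret comm_group G by (rule G)
  obtain xs where xs: "set xs = carrier G" "distinct xs"
    using G(2) finite_distinct_list by blast
  define ys where "ys = sort_key w xs"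
  have ys: "set ys = carrier G" "distinct ys" "sorted (map w ys)"
    by (simp_all add: ys_def xs)
  have len: "length ys = n"
    using distinct_card[OF ys(2)] G(3) by (simp add: ys(1) order_def)
  have n: "n > 0"
    using len ys(1) one_closed by (cases ys) auto
  have bij: "bij_betw ((!) ys) {..<n} (carrier G)"
    using ys len by (intro bij_betw_nth) auto
  have mono: "w (ys ! i) \<le> w (ys ! j)" if "i \<le> j" "j < n" for i j
    using sorted_nth_mono[OF ys(3), of i j] that len by simp
  have w1: "w \<one>\<^bsub>G\<^esub> = 0"
    using pos(2) by simp
  have ys_0: "ys ! 0 = \<one>\<^bsub>G\<^esub>"
  proof -
    have "\<one>\<^bsub>G\<^esub> \<in> set ys"
      by (simp add: ys(1))
    then obtain i where i: "i < n" "ys ! i = \<one>\<^bsub>G\<^esub>"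
      unfolding in_set_conv_nth len by blast
    have car: "ys ! 0 \<in> carrier G"
      using n len ys(1) nth_mem[of 0 ys] by simp
    have "w (ys ! 0) \<le> 0"
      using mono[of 0 i] i w1 by simp
    with pos(1)[OF car] pos(2)[OF car] show ?thesis
      by simp
  qed
  have upper: "w (ys ! i) \<le> u" if "i < card {g \<in> carrier G. w g \<le> u}" "i < n" for i u
  proof (rule ccontr)
    assume "\<not> w (ys ! i) \<le> u"
    have "{g \<in> carrier G. w g \<le> u} \<subseteq> (!) ys ` {..<i}"
    proof
      fix g
      assume g: "g \<in> {g \<in> carrier G. w g \<le> u}"
      then obtain k where k: "k < n" "g = ys ! k"
        unfolding ys(1)[symmetric] len[symmetric] by (auto simp: in_set_conv_nth)
      then have "k < i"
        using mono[of i k] g \<open>\<not> w (ys ! i) \<le> u\<close> by (cases "k < i") auto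
      with k show "g \<in> (!) ys ` {..<i}"
        by simp
    qed
    then have "card {g \<in> carrier G. w g \<le> u} \<le> i"
      using surj_card_le[of "{..<i}"] by simp
    with that show False by simp
  qed
  have lower: "w (ys ! i) > u" if "card {g \<in> carrier G. w g \<le> u} \<le> i" "i < n" for i u
  proof (rule ccontr)
    assume "\<not> w (ys ! i) > u"
    then have "w (ys ! k) \<le> u" "ys ! k \<in> carrier G" if "k \<le> i" for k
      using mono[of k i] that \<open>i < n\<close> unfolding ys(1)[symmetric] len[symmetric] by auto
    then have "(!) ys ` {..i} \<subseteq> {g \<in> carrier G. w g \<le> u}"
      by auto
    then have "card ((!) ys ` {..i}) \<le> card {g \<in> carrier G. w g \<le> u}"
      using G(2) by (intro card_mono) auto
    moreover have "card ((!) ys ` {..i}) = Suc i"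
      using ys(2) len that by (subst card_image) (auto simp: inj_on_nth)
    ultimately show False
      using that by simp
  qed
  define x where "x = (\<lambda>i\<in>{1..<n}. real_of_int (w (ys ! i)))"
  have "\<exists>T. flag_type n T \<and> realizable n T \<and> x \<in> flag_polytope n T"
    unfolding x_def
  proof (rule realizable_of_enumeration[where G = G and w = "\<lambda>g. real_of_int (w g)" and e = "(!) ys"])
    show "real_of_int (w (g \<otimes>\<^bsub>G\<^esub> h)) \<le> real_of_int (w g) + real_of_int (w h)"
      if "g \<in> carrier G" "h \<in> carrier G" for g h
      using sub[OF that] by linarith
  qed (use G n bij ys_0 w1 mono in auto)
  moreover have "x \<notin> flag_polytope n (tuple_flag_type ps)"
    if ps: "\<forall>p\<in>set ps. prime p" "prod_list ps = n" for ps
  proof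
    assume x: "x \<in> flag_polytope n (tuple_flag_type ps)"
    obtain i j u v where ij: "no_carry ps i j" "0 < i" "0 < j" "i + j < n"
      "i < card {g \<in> carrier G. w g \<le> u}" "j < card {g \<in> carrier G. w g \<le> v}"
      "card {g \<in> carrier G. w g \<le> u + v} \<le> i + j"
      using sep[OF ps] by blast
    have "\<forall>p\<in>set ps. p > 1"
      using ps by (auto simp: prime_gt_Suc_0_nat)
    then have "x (i + j) \<le> x i + x j"
      using flag_polytope_tuple_le[of x ps i j] x ps ij by simp
    moreover have "w (ys ! (i + j)) > u + v" "w (ys ! i) \<le> u" "w (ys ! j) \<le> v"
      using ij upper[of i u] upper[of j v] lower[of "u + v" "i + j"] by auto
    ultimately show False
      using ij by (simp add: x_def)
  qed
  ultimately show ?thesis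
    by blast
qed

subsection \<open>The two families of length functions\<close>

abbreviation box_group :: "nat \<Rightarrow> nat \<Rightarrow> nat \<Rightarrow> (int \<times> int \<times> int) monoid" where
  "box_group a b m \<equiv>
     integer_mod_group a \<times>\<times> integer_mod_group b \<times>\<times> integer_mod_group m"

lemma box_group:
  assumes "a > 0" "b > 0" "m > 0"
  shows "comm_group (box_group a b m)"
    and "carrier (box_group a b m) = {0..<int a} \<times> {0..<int b} \<times> {0..<int m}"
    and "order (box_group a b m) = a * b * m"
proof -
  show "comm_group (box_group a b m)"
    by (rule group.group_comm_groupI) (auto intro!: DirProd_group simp: add.commute)
  show car: "carrier (box_group a b m) = {0..<int a} \<times> {0..<int b} \<times> {0..<int m}"
    using assms by (simp add: carrier_integer_mod_group)
  show "order (box_group a b m) = a * b * m"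
    unfolding order_def car by (simp add: card_cartesian_product)
qed

text \<open>Trades modular reduction for a case split, so that subadditivity of the length functions
  becomes linear arithmetic.\<close>

lemma add_mod_if:
  fixes x y m :: int
  assumes "0 \<le> x" "x < m" "0 \<le> y" "y < m"
  shows "(x + y) mod m = (if x + y < m then x + y else x + y - m)"
proof (cases "x + y < m")
  case False
  then have "(x + y - m) mod m = x + y - m"
    using assms by (intro mod_pos_pos_trivial) auto
  with False show ?thesis
    by simp
qed (use assms in simp)

text \<open>Since \<open>i, j < p * q\<close>, these fill the two lowest digits, and
  \<open>s\<close> and \<open>t\<close> are exactly what lies above.\<close>

lemma no_carry_above_two_digits:
  assumes "p > 0" "q > 0" "i < p * q" "j < p * q" "no_carry [p, q] i j" "no_carry ps s t"
  shows "no_carry (p # q # ps) (s * (p * q) + i) (t * (p * q) + j)"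
proof -
  have digits: "(s * (p * q) + i) mod p = i mod p" "(s * (p * q) + i) div p mod q = i div p mod q"
    "(s * (p * q) + i) div p div q = s" if "i < p * q" for s i
  proof -
    have "s * (p * q) + i = i + p * (s * q)"
      by simp
    then have div_p: "(s * (p * q) + i) div p = s * q + i div p"
      using assms(1) by (metis add.commute div_mult_self2 not_gr_zero)
    show "(s * (p * q) + i) mod p = i mod p"
      by (metis mod_mult_self3 mult.assoc mult.commute)
    show "(s * (p * q) + i) div p mod q = i div p mod q"
      unfolding div_p by simp
    have "i div p < q"
      using that by (simp add: less_mult_imp_div_less mult.commute)
    then show "(s * (p * q) + i) div p div q = s"
      unfolding div_p using assms(2) by simp
  qed
  show ?thesis
    using assms by (simp add: digits)
qed

text \<open>The sum \<open>1 + 1\<close> carries only if the first prime is \<open>2\<close>. Then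
  \<open>s = 2\<close> serves: the product is even and above \<open>2\<close>, hence exceeds
  \<open>3\<close>.\<close>

lemma ex_no_carry_product_gt_2:
  assumes "\<forall>p\<in>set ps. prime p" "prod_list ps > 2"
  shows "\<exists>s>0. s + 1 < prod_list ps \<and> no_carry ps 1 s"
proof -
  obtain r rs where ps: "ps = r # rs"
    using assms(2) by (cases ps) auto
  have r: "prime r" and rs: "\<forall>p\<in>set rs. p > 0"
    using assms(1) ps by (auto simp: prime_gt_0_nat)
  show ?thesis
  proof (cases "r = 2")
    case True
    have "no_carry ps 1 2"
      using rs by (simp add: ps True no_carry_0)
    moreover have "2 + 1 < prod_list ps"
      using assms(2) ps True by (auto simp: ps True; presburger)
    ultimately show ?thesis
      by (intro exI[of _ 2]) auto
  next
    case False
    then have "r > 2"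
      using prime_ge_2_nat[OF r] by simp
    then have "no_carry ps 1 1"
      using rs by (simp add: ps no_carry_0)
    then show ?thesis
      using assms(2) by (intro exI[of _ 1]) auto
  qed
qed

lemma coset_tower_flag_type:
  assumes p: "prime p" and q: "prime q" and pq: "p \<noteq> q" and m: "m > 2" and n: "n = p * q * m"
  shows "\<exists>T. flag_type n T \<and> realizable n T \<and>
           \<not> flag_polytope n T \<subseteq>
             (\<Union>ps \<in> {ps. (\<forall>p\<in>set ps. prime p) \<and> prod_list ps = n}.
                flag_polytope n (tuple_flag_type ps))"
proof -
  have pos: "p > 1" "q > 1"
    using p q by (auto simp: prime_gt_Suc_0_nat)
  then have pos0: "p > 0" "q > 0" "m > 0"
    using m by auto
  let ?G = "box_group p q m"
  \<comment> \<open>The gaps 1 < 3 < 10 are wide enough that the sublevel sets of \<open>1\<close>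
    and \<open>3\<close>, subgroups of orders \<open>p\<close> and \<open>p * q\<close>, do not grow
    when the bound is doubled. For \<open>c > 0\<close> the term \<open>10 * c\<close> dominates,
    and the elements with \<open>\<alpha> = 0\<close> come first in each coset.\<close>
  define w :: "int \<times> int \<times> int \<Rightarrow> int" where
    "w = (\<lambda>(\<alpha>, \<beta>, c). if c = 0 then if \<beta> \<noteq> 0 then 3 else if \<alpha> \<noteq> 0 then 1 else 0
                       else 10 * c + (if \<alpha> \<noteq> 0 then 1 else 0))"
  note car = box_group(2)[OF pos0]
  let ?lev = "\<lambda>v. {g \<in> carrier ?G. w g \<le> v}"
  define N where "N v = card (?lev v)" for v
  have lev_p: "N v = p" if "v = 1 \<or> v = 2" for v
  proof -
    have "?lev v = {0..<int p} \<times> {0} \<times> {0}"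
      unfolding car using pos0 that by (auto simp: w_def split: if_splits)
    then show ?thesis
      by (simp add: N_def card_cartesian_product)
  qed
  have lev_pq: "N v = p * q" if "v = 3 \<or> v = 6" for v
  proof -
    have "?lev v = {0..<int p} \<times> {0..<int q} \<times> {0}"
      unfolding car using pos0 that by (auto simp: w_def split: if_splits)
    then show ?thesis
      by (simp add: N_def card_cartesian_product)
  qed
  have lev_c: "N (10 * int c) = c * (p * q) + q" if "0 < c" "c < m" for c
  proof -
    have "?lev (10 * int c) =
        {0..<int p} \<times> {0..<int q} \<times> {0..<int c} \<union> {0} \<times> {0..<int q} \<times> {int c}"
      unfolding car using pos0 that by (auto simp: w_def split: if_splits)
    moreover have "card \<dots> = p * (q * c) + q"
      by (subst card_Un_disjoint) (auto simp: card_cartesian_product)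
    ultimately show ?thesis
      by (simp add: N_def algebra_simps)
  qed
  show ?thesis
  proof (rule flag_type_of_length_function[where G = ?G and w = w])
    show "comm_group ?G" "order ?G = n"
      using box_group[OF pos0] n by simp_all
    show "finite (carrier ?G)"
      unfolding car by simp
    show "w g \<ge> 0" if "g \<in> carrier ?G" for g
      using that unfolding car by (auto simp: w_def)
    show "w g = 0 \<longleftrightarrow> g = \<one>\<^bsub>?G\<^esub>" if "g \<in> carrier ?G" for g
      using that unfolding car by (cases g) (auto simp: w_def)
    show "w (g \<otimes>\<^bsub>?G\<^esub> h) \<le> w g + w h" if "g \<in> carrier ?G" "h \<in> carrier ?G" for g h
    proof -
      obtain \<alpha> \<beta> c \<alpha>' \<beta>' c' where gh: "g = (\<alpha>, \<beta>, c)" "h = (\<alpha>', \<beta>', c')"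
        by (metis surj_pair)
      have c: "0 \<le> c" "c < int m" "0 \<le> c'" "c' < int m"
        using that unfolding gh car by auto
      have "(\<alpha> + \<alpha>') mod int p \<noteq> 0 \<longrightarrow> \<alpha> \<noteq> 0 \<or> \<alpha>' \<noteq> 0" "(\<beta> + \<beta>') mod int q \<noteq> 0 \<longrightarrow> \<beta> \<noteq> 0 \<or> \<beta>' \<noteq> 0"
        by auto
      moreover note add_mod_if[OF c]
      moreover have "int m \<ge> 3"
        using m by simp
      ultimately show ?thesis
        using c unfolding gh by (auto simp: w_def split: if_splits)
    qed
  next
    fix ps
    assume ps: "\<forall>p\<in>set ps. prime p" "prod_list ps = n"
    then have ps1: "\<forall>p\<in>set ps. p > 1"
      by (auto simp: prime_gt_Suc_0_nat)
    have less: "p < n" "p * q < n"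
      using pos m less_1_mult[of q m] by (auto simp: n)
    have "\<exists>i j u v. no_carry ps i j \<and> 0 < i \<and> 0 < j \<and> i + j < n \<and>
        i < N u \<and> j < N v \<and> N (u + v) \<le> i + j"
    \<comment> \<open>If \<open>p\<close> or \<open>p * q\<close> is not a partial product, it is a
      carry-free sum \<open>i + j\<close>. Both indices lie in the subgroup of that order, but their
      sum is the first index outside it.\<close>
    proof (cases "\<exists>k l. p = prod_list (take k ps) \<and> p * q = prod_list (take l ps)")
      case False
      then consider "\<And>k. p \<noteq> prod_list (take k ps)" | "\<And>k. p * q \<noteq> prod_list (take k ps)"
        by blast
      then show ?thesis
      proof cases
        case 1
        then obtain i j where "0 < i" "0 < j" "i + j = p" "no_carry ps i j"
          using ex_no_carry_decomp[OF ps1, of p] less ps pos0 by auto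
        then show ?thesis
          using less by (intro exI[of _ i] exI[of _ j] exI[of _ 1] exI[of _ 1]) (simp add: lev_p)
      next
        case 2
        then obtain i j where "0 < i" "0 < j" "i + j = p * q" "no_carry ps i j"
          using ex_no_carry_decomp[OF ps1, of "p * q"] less ps pos0 by auto
        then show ?thesis
          using less by (intro exI[of _ i] exI[of _ j] exI[of _ 3] exI[of _ 3]) (simp add: lev_pq)
      qed
    next
      case True
      then obtain k l where kl: "p = prod_list (take k ps)" "p * q = prod_list (take l ps)"
        by blast
      obtain qs where qs: "ps = p # qs"
        using prime_eq_prod_list_take[OF ps(1) p kl(1)] by blast
      have "q = prod_list (take (l - 1) qs)"
        using kl(2) pos unfolding qs by (cases l) auto
      then obtain rs where "qs = q # rs"
        using prime_eq_prod_list_take[of qs q] ps q qs by auto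
      with qs have rs: "ps = p # q # rs"
        by simp
      have prod_rs: "prod_list rs = m"
        using ps(2) pos unfolding rs n by auto
      obtain s where s: "s > 0" "s + 1 < m" "no_carry rs 1 s"
        using ex_no_carry_product_gt_2[of rs] ps(1) m unfolding rs prod_rs by auto
      \<comment> \<open>The place values are \<open>1\<close>, \<open>p\<close> and
        \<open>p * q\<close>; as \<open>p \<noteq> q\<close>, the number \<open>q\<close> is none of
        them and splits within the two lowest digits.\<close>
      have "q \<noteq> prod_list (take k [p, q])" for k
      proof -
        have "take k [p, q] \<in> {[], [p], [p, q]}"
          by (cases k; cases "k - 1") auto
        then show ?thesis
          using pos pq by auto
      qed
      then obtain \<alpha> \<beta> where ab: "\<alpha> > 0" "\<beta> > 0" "\<alpha> + \<beta> = q" "no_carry [p, q] \<alpha> \<beta>"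
        using ex_no_carry_decomp[of "[p, q]" q] pos by auto
      have qpq: "q < p * q"
        using pos by simp
      have "\<alpha> < p * q" "\<beta> < p * q"
        using ab qpq by linarith+
      \<comment> \<open>As \<open>\<alpha>, \<beta> < q\<close>, the two indices are inside the
        sublevel sets of \<open>10\<close> and \<open>10 * s\<close>; their sum is the size of the
        sublevel set of \<open>10 * (s + 1)\<close>, hence just outside.\<close>
      then have "no_carry ps (1 * (p * q) + \<alpha>) (s * (p * q) + \<beta>)"
        unfolding rs using ab(4) s(3) pos0 by (intro no_carry_above_two_digits)
      moreover have "1 * (p * q) + \<alpha> < N (10 * int 1)"
        using ab m by (subst lev_c) auto
      moreover have "s * (p * q) + \<beta> < N (10 * int s)"
        using ab s by (subst lev_c) auto
      moreover have sum: "1 * (p * q) + \<alpha> + (s * (p * q) + \<beta>) = (s + 1) * (p * q) + q"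
        using ab by simp
      moreover have "N (10 * int 1 + 10 * int s) = (s + 1) * (p * q) + q"
        using lev_c[of "s + 1"] s by (simp add: algebra_simps)
      moreover have "(s + 1) * (p * q) + q < n"
      proof -
        have "(s + 1) * (p * q) + q < (s + 2) * (p * q)"
          using qpq by simp
        also have "\<dots> \<le> m * (p * q)"
          using s by (intro mult_le_mono1) simp
        finally show ?thesis
          by (simp add: n mult_ac)
      qed
      moreover have "0 < 1 * (p * q) + \<alpha>" "0 < s * (p * q) + \<beta>"
        using ab by simp_all
      ultimately show ?thesis
        by (intro exI[of _ "1 * (p * q) + \<alpha>"] exI[of _ "s * (p * q) + \<beta>"]
            exI[of _ "10 * int 1"] exI[of _ "10 * int s"] conjI) (simp_all only: order_refl)
    qed
    then show "\<exists>i j u v. no_carry ps i j \<and> 0 < i \<and> 0 < j \<and> i + j < n \<and>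
        i < card (?lev u) \<and> j < card (?lev v) \<and> card (?lev (u + v)) \<le> i + j"
      unfolding N_def .
  qed
qed

lemma four_prime_flag_type:
  assumes q: "prime q" and q5: "q \<ge> 5" and n: "n = 4 * q"
  shows "\<exists>T. flag_type n T \<and> realizable n T \<and>
           \<not> flag_polytope n T \<subseteq>
             (\<Union>ps \<in> {ps. (\<forall>p\<in>set ps. prime p) \<and> prod_list ps = n}.
                flag_polytope n (tuple_flag_type ps))"
proof -
  have "odd q"
    using q q5 prime_odd_nat by auto
  then obtain t where t: "q = 2 * t + 1"
    by (auto elim: oddE)
  have pos0: "(2::nat) > 0" "q > 0" "(2::nat) > 0"
    using q5 by auto
  let ?G = "box_group 2 q 2"
  \<comment> \<open>The weight 11 of \<open>(1, 0, 0)\<close> lets \<open>(0, 1, 0)\<close>, of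
    weight 10, come first. As 11 is the least weight with \<open>\<epsilon> \<noteq> 0\<close>,
    raising the values with \<open>\<tau> \<noteq> 0\<close> and
    \<open>\<epsilon> \<noteq> 0\<close> by 11 keeps \<open>w\<close> subadditive.\<close>
  define w :: "int \<times> int \<times> int \<Rightarrow> int" where
    "w = (\<lambda>(\<epsilon>, k, \<tau>). if \<tau> = 0 then if \<epsilon> = 0 then 10 * k else if k = 0 then 11 else 10 * k + 1
                       else 10 * int q + (if \<epsilon> = 0 then 0 else 11))"
  note car = box_group(2)[OF pos0]
  let ?lev = "\<lambda>v. {g \<in> carrier ?G. w g \<le> v}"
  define N where "N v = card (?lev v)" for v
  have fin: "finite (?lev v)" for v
    unfolding car by simp
  have lev_10: "N 10 > 1"
  proof -
    have "{0} \<times> {0, 1} \<times> {0} \<subseteq> ?lev 10"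
      unfolding car using q5 by (auto simp: w_def)
    from card_mono[OF fin this] show ?thesis
      by (simp add: N_def card_cartesian_product)
  qed
  \<comment> \<open>The next weight is \<open>10 * q + 11\<close>, so multiplying by the first
    nontrivial element, of weight 10, adds nothing.\<close>
  have lev_top: "N v = 3 * q" if "v = 10 * int q \<or> v = 10 * int q + 10" for v
  proof -
    have "?lev v = {0..<2} \<times> {0..<int q} \<times> {0} \<union> {0} \<times> {0..<int q} \<times> {1}"
      unfolding car using that q5 by (auto simp: w_def split: if_splits)
    moreover have "card \<dots> = 2 * q + q"
      by (subst card_Un_disjoint) (auto simp: card_cartesian_product)
    ultimately show ?thesis
      by (simp add: N_def)
  qed
  have lev_11: "N 11 > 3"
  proof -
    have "{0, 1} \<times> {0, 1} \<times> {0} \<subseteq> ?lev 11"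
      unfolding car using q5 by (auto simp: w_def)
    from card_mono[OF fin this] show ?thesis
      by (simp add: N_def card_cartesian_product)
  qed
  \<comment> \<open>The cosets with \<open>k \<le> t\<close> already contain
    \<open>2 * (t + 1) = q + 1\<close> elements.\<close>
  have lev_q: "N (10 * int t + 1) > q"
  proof -
    have "{0, 1} \<times> {0..int t} \<times> {0} \<subseteq> ?lev (10 * int t + 1)"
      unfolding car using q5 t by (auto simp: w_def)
    from card_mono[OF fin this] show ?thesis
      using t by (simp add: N_def card_cartesian_product)
  qed
  \<comment> \<open>The bound \<open>10 * t + 12\<close> is below \<open>10 * (t + 2)\<close> and
    \<open>10 * q\<close>, leaving only \<open>k \<le> t + 1\<close> and \<open>\<tau> = 0\<close>:
    at most \<open>2 * (t + 2) = q + 3\<close> elements.\<close>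
  have lev_q3: "N (11 + (10 * int t + 1)) \<le> 3 + q"
  proof -
    have "?lev (11 + (10 * int t + 1)) \<subseteq> {0, 1} \<times> {0..int t + 1} \<times> {0}"
      unfolding car using q5 t by (auto simp: w_def split: if_splits)
    from card_mono[OF _ this] show ?thesis
      using t by (simp add: N_def card_cartesian_product)
  qed
  show ?thesis
  proof (rule flag_type_of_length_function[where G = ?G and w = w])
    show "comm_group ?G" "order ?G = n"
      using box_group[OF pos0] n by simp_all
    show "finite (carrier ?G)"
      unfolding car by simp
    show "w g \<ge> 0" if "g \<in> carrier ?G" for g
      using that unfolding car by (auto simp: w_def)
    show "w g = 0 \<longleftrightarrow> g = \<one>\<^bsub>?G\<^esub>" if "g \<in> carrier ?G" for g
      using that q5 unfolding car by (cases g) (auto simp: w_def)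
    show "w (g \<otimes>\<^bsub>?G\<^esub> h) \<le> w g + w h" if "g \<in> carrier ?G" "h \<in> carrier ?G" for g h
    proof -
      obtain \<epsilon> k \<tau> \<epsilon>' k' \<tau>' where gh: "g = (\<epsilon>, k, \<tau>)" "h = (\<epsilon>', k', \<tau>')"
        by (metis surj_pair)
      have k: "0 \<le> k" "k < int q" "0 \<le> k'" "k' < int q"
        and "\<epsilon> \<in> {0, 1}" "\<epsilon>' \<in> {0, 1}" "\<tau> \<in> {0, 1}" "\<tau>' \<in> {0, 1}"
        using that unfolding gh car by auto
      moreover note add_mod_if[OF k]
      moreover have "int q \<ge> 5"
        using q5 by simp
      ultimately show ?thesis
        unfolding gh by (auto simp: w_def)
    qed
  next
    fix ps
    assume ps: "\<forall>p\<in>set ps. prime p" "prod_list ps = n"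
    obtain r rs where rs: "ps = r # rs"
      using ps(2) n q5 by (cases ps) auto
    have rs0: "\<forall>p\<in>set rs. p > 0"
      using ps(1) rs by (auto simp: prime_gt_0_nat)
    have "r * prod_list rs = 2 * 2 * q"
      using ps(2) rs n by simp
    then have "r dvd 2 * 2 * q"
      by (metis dvd_triv_left)
    moreover have "prime r"
      using ps(1) rs by simp
    ultimately have "r dvd 2 \<or> r dvd q"
      by (simp only: prime_dvd_mult_iff) blast
    then have "r = 2 \<or> r = q"
      using primes_dvd_imp_eq[OF \<open>prime r\<close>] q two_is_prime_nat by blast
    then have "\<exists>i j u v. no_carry ps i j \<and> 0 < i \<and> 0 < j \<and> i + j < n \<and>
        i < N u \<and> j < N v \<and> N (u + v) \<le> i + j"
    proof
      assume r: "r = 2"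
      have "even (3 * q - 1)"
        using t by simp
      then have "no_carry ps 1 (3 * q - 1)"
        using rs0 by (simp add: rs r no_carry_0)
      moreover have "1 + (3 * q - 1) = 3 * q" "3 * q < n"
        using q5 n by simp_all
      moreover have "3 * q - 1 < N (10 * int q)" "N (10 + 10 * int q) \<le> 3 * q"
        using lev_top[of "10 * int q"] lev_top[of "10 + 10 * int q"] q5 by simp_all
      ultimately show ?thesis
        using lev_10 q5 by (intro exI[of _ 1] exI[of _ "3 * q - 1"] exI[of _ 10] exI[of _ "10 * int q"]) simp
    next
      assume r: "r = q"
      \<comment> \<open>By \<open>q \<ge> 5\<close> the number \<open>3\<close> is a single digit,
        while \<open>q\<close> has lowest digit \<open>0\<close>.\<close>
      have "no_carry ps 3 q"
        using rs0 q5 by (simp add: rs r no_carry_0)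
      moreover have "3 + q < n"
        using q5 n by simp
      ultimately show ?thesis
        using lev_11 lev_q lev_q3 q5
        by (intro exI[of _ 3] exI[of _ q] exI[of _ 11] exI[of _ "10 * int t + 1"]) simp
    qed
    then show "\<exists>i j u v. no_carry ps i j \<and> 0 < i \<and> 0 < j \<and> i + j < n \<and>
        i < card (?lev u) \<and> j < card (?lev v) \<and> card (?lev (u + v)) \<le> i + j"
      unfolding N_def .
  qed
qed

section \<open>Reduction to the two families of degrees\<close>

text \<open>Not being a prime power yields distinct prime divisors \<open>p\<close> and
  \<open>q\<close>, and the cofactor \<open>m\<close> is not \<open>1\<close>. Only
  \<open>m = 2\<close> needs care: if \<open>p\<close> or \<open>q\<close> is \<open>2\<close>, then
  \<open>n\<close> is four times the other.\<close>

lemma factorization_cases: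
  fixes n :: nat
  assumes "n \<ge> 2"
    and "\<not> (\<exists>p k. prime p \<and> k \<ge> 1 \<and> n = p ^ k)"
    and "\<not> (\<exists>p q. prime p \<and> prime q \<and> p \<noteq> q \<and> n = p * q)"
  obtains (tower) p q m where "prime p" "prime q" "p \<noteq> q" "m > 2" "n = p * q * m"
    | (four) q where "prime q" "q \<noteq> 2" "n = 4 * q"
proof -
  obtain p where p: "prime p" "p dvd n"
    using assms(1) prime_factor_nat[of n] by auto
  define k where "k = multiplicity p n"
  obtain n' where n': "n = p ^ k * n'" "\<not> p dvd n'"
    using multiplicity_decompose'[of n p] p assms(1) unfolding k_def
    by (metis not_prime_unit not_numeral_le_zero)
  have k: "k \<ge> 1"
    using p n' by (cases k) auto
  have "n' \<noteq> 1"
    using assms(2) n'(1) p(1) k by (metis mult.right_neutral)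
  then obtain q where q: "prime q" "q dvd n'"
    using prime_factor_nat by blast
  have pq: "p \<noteq> q"
    using n' q by auto
  obtain m where m: "n = p * q * m"
    using n'(1) k q(2) by (metis One_nat_def Suc_le_D dvd_def mult.assoc mult.left_commute power_Suc)
  have "m \<noteq> 0"
    using m assms(1) by (metis mult_0_right not_numeral_le_zero)
  moreover have "m \<noteq> 1"
    using m assms(3) p(1) q(1) pq by (metis mult.right_neutral)
  ultimately consider "m > 2" | "m = 2" "p = 2" | "m = 2" "q = 2" | "m = 2" "p \<noteq> 2" "q \<noteq> 2"
    by linarith
  then show ?thesis
  proof cases
    case 1
    then show ?thesis
      using tower p q pq m by blast
  next
    case 2
    then show ?thesis
      using four[of q] q pq m by auto
  next
    case 3
    then show ?thesis
      using four[of p] p pq m by auto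
  next
    case 4
    \<comment> \<open>The primes \<open>2\<close> and \<open>p\<close> now take the leading roles,
      with \<open>q\<close> as cofactor.\<close>
    then have "q > 2"
      using prime_ge_2_nat[OF q(1)] by simp
    then show ?thesis
      using tower[of 2 p q] 4 p m by (auto simp: mult_ac)
  qed
qed

theorem theorem6p1:
  fixes n :: nat
  assumes "n \<ge> 2"
    and "\<not> (\<exists>p k. prime p \<and> k \<ge> 1 \<and> n = p ^ k)"
    and "\<not> (\<exists>p q. prime p \<and> prime q \<and> p \<noteq> q \<and> n = p * q)"
    and "n \<noteq> 12"
  shows "\<exists>T. flag_type n T \<and> realizable n T \<and>
           \<not> flag_polytope n T \<subseteq>
             (\<Union>ps \<in> {ps. (\<forall>p\<in>set ps. prime p) \<and> prod_list ps = n}.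
                flag_polytope n (tuple_flag_type ps))"
  using assms(1-3)
proof (cases rule: factorization_cases)
  case (tower p q m)
  then show ?thesis
    by (rule coset_tower_flag_type)
next
  case (four q)
  \<comment> \<open>\<open>n \<noteq> 12\<close> excludes \<open>q = 3\<close>, and \<open>4\<close>
    is not prime.\<close>
  have "q \<noteq> 3" "q \<noteq> 4"
    using four assms(4) by auto
  then have "q \<ge> 5"
    using four prime_ge_2_nat[of q] by linarith
  with four show ?thesis
    using four_prime_flag_type by blast
qed

end
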